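(* For each $\alpha>0$ there exists a constant $c_\alpha>0$ such that for any label-invariant estimator $\widehat\sigma$ and any $n\ge2$, $$R_\alpha(\widehat\sigma)\ \ge\ \begin{cases} c_\alpha n^{2-\alpha}, & \text{if }\alpha\in(0,2),\\ c_\alpha\log n, & \text{if }\alpha=2,\\ c_\alpha, & \text{if }\alpha>2.\end{cases}$$
   Context: The uniform random recursive tree $T_n$ on vertex set $[n]=\{1,\dots,n\}$ is sampled recursively: $T_1$ is the single vertex $1$ (the root); given $T_n$, choose $u\in\{1,\dots,n\}$ uniformly at random, independently of $T_1,\dots,T_n$, and add a new vertex $n+1$ together with the edge $\{u,n+1\}$. The label of a vertex is its arrival time. For a tree $t$ with vertex set $[n]$ and a permutation $\tau$ of $[n]$, $t^\tau$ is the labeled tree obtained by permuting the vertex labels by $\tau$. An (arrival-time) estimator assigns to each labeled tree $t$ on $[n]$ a (possibly random) bijection $\widehat\sigma(\cdot,t):[n]\to[n]$. It is label-invariant if, for every fixed labeled tree $t$, every permutation $\tau$ of its vertices and every vertex $u$, $\widehat\sigma(u,t)$ and $\widehat\sigma(\tau(u),t^\tau)$ have the same distribution. Write $\widehat\sigma(v)=\widehat\sigma(v,T_n)$, whose conditional law given $T_n=t$ is that of $\widehat\sigma(v,t)$. The risk is $$R_\alpha(\widehat\sigma)=\mathbb{E}\Big[\sum_{v\in[n]}\frac{|\widehat\sigma(v)-v|}{v^\alpha}\Big],\qquad \alpha>0.$$ *)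

theory Defs
  imports "HOL-Probability.Probability" "HOL-Combinatorics.Permutations"
begin

text \<open>A graph with vertex set \<open>{1..n}\<close> is represented by its set of edges, each edge being a
  two-element set of vertices.\<close>

type_synonym graph = "nat set set"

definition adjacent :: "graph \<Rightarrow> nat \<Rightarrow> nat \<Rightarrow> bool" where
  "adjacent t x y \<longleftrightarrow> {x, y} \<in> t"

definition is_cycle :: "graph \<Rightarrow> nat list \<Rightarrow> bool" where
  "is_cycle t p \<longleftrightarrow>
     3 \<le> length p \<and> distinct p \<and> successively (adjacent t) p \<and> adjacent t (last p) (hd p)"

definition labeled_tree :: "nat \<Rightarrow> graph \<Rightarrow> bool" where
  "labeled_tree n t \<longleftrightarrow>
     (\<forall>e\<in>t. e \<subseteq> {1..n} \<and> card e = 2) \<and>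
     (\<forall>x\<in>{1..n}. \<forall>y\<in>{1..n}. (adjacent t)\<^sup>*\<^sup>* x y) \<and>
     (\<nexists>p. is_cycle t p)"

definition relabel :: "(nat \<Rightarrow> nat) \<Rightarrow> graph \<Rightarrow> graph" where
  "relabel \<tau> t = (\<lambda>e. \<tau> ` e) ` t"

text \<open>The law of the uniform random recursive tree \<open>T\<^sub>n\<close>. The value at \<open>n = 0\<close> has no meaning.\<close>

fun urrt :: "nat \<Rightarrow> graph pmf" where
  "urrt 0 = return_pmf {}"
| "urrt (Suc 0) = return_pmf {}"
| "urrt (Suc (Suc n)) =
     bind_pmf (urrt (Suc n)) (\<lambda>t.
       map_pmf (\<lambda>u. insert {u, Suc (Suc n)} t) (pmf_of_set {1..Suc n}))"

text \<open>A random bijection of \<open>{1..n}\<close> is given by its law. Bijections are extended to all of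
  \<open>nat\<close> by the identity, so there are finitely many of them and discrete laws lose no generality.
  Only the values at labeled trees on \<open>{1..n}\<close> matter.\<close>

type_synonym estimator = "graph \<Rightarrow> (nat \<Rightarrow> nat) pmf"

definition is_estimator :: "nat \<Rightarrow> estimator \<Rightarrow> bool" where
  "is_estimator n \<sigma> \<longleftrightarrow>
     (\<forall>t. labeled_tree n t \<longrightarrow> set_pmf (\<sigma> t) \<subseteq> {s. s permutes {1..n}})"

text \<open>Equality in distribution is required for each vertex separately, not for the joint law of the
  whole bijection.\<close>

definition label_invariant :: "nat \<Rightarrow> estimator \<Rightarrow> bool" where
  "label_invariant n \<sigma> \<longleftrightarrow>
     (\<forall>t \<tau> u. labeled_tree n t \<and> \<tau> permutes {1..n} \<and> u \<in> {1..n} \<longrightarrow>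
        map_pmf (\<lambda>s. s u) (\<sigma> t) = map_pmf (\<lambda>s. s (\<tau> u)) (\<sigma> (relabel \<tau> t)))"

text \<open>The mixture below is the unconditional law of the estimator applied to \<open>T\<^sub>n\<close>; the loss depends
  on the tree only through the estimated bijection.\<close>

definition risk :: "real \<Rightarrow> nat \<Rightarrow> estimator \<Rightarrow> real" where
  "risk \<alpha> n \<sigma> = measure_pmf.expectation (bind_pmf (urrt n) \<sigma>)
     (\<lambda>s. \<Sum>v\<in>{1..n}. \<bar>real (s v) - real v\<bar> / real v powr \<alpha>)"

end

theory Submission
  imports Defs
begin

text \<open>
  A label-invariant estimator cannot tell two vertices apart when exchanging their labels turns the
  observed tree into another tree that is just as likely. The law of \<open>T\<^sub>n\<close> is uniform on the
  recursive trees, those whose labels increase along every path from the root (lemma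
  \<open>urrt_uniform\<close>), so this happens for \<open>v\<close> and \<open>w\<close> whenever exchanging
  them in a recursive tree \<open>t\<close> gives a recursive tree \<open>t'\<close>. By invariance the guess for
  \<open>w\<close> in \<open>t'\<close> has the law of the guess for \<open>v\<close> in \<open>t\<close>, and one number cannot be
  close to both \<open>v\<close> and \<open>w\<close>. The exchange is an involution on the set of these trees, so
  averaging over them gives that the expected errors at \<open>v\<close> and \<open>w\<close> add up to at least
  \<open>\<bar>v - w\<bar>\<close> times the probability of the set (lemma \<open>arrival_error_pair_ge\<close>).

  Take \<open>w = 2 * v\<close>. For \<open>v \<ge> 2\<close> the exchange keeps the tree recursive if the parent of
  \<open>w\<close> arrived before \<open>v\<close> and \<open>v\<close> got no child before time \<open>w\<close>. These
  attachments are independent; the first event has probability \<open>(v - 1) / (2 * v - 1)\<close>, the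
  second one \<open>1 / 2\<close> by a telescoping product. For \<open>v = 1\<close> the exchange always keeps the
  tree recursive, since the vertices 1 and 2 are adjacent and all others come later. Hence the
  probability is at least \<open>1 / 6\<close> for every \<open>v \<le> n / 2\<close>
  (lemma \<open>prob_swappable_double_ge\<close>).

  In the sum over \<open>v \<le> n / 2\<close> of these pair bounds with weight \<open>(2 * v) powr (-\<alpha>)\<close>, a vertex
  occurs at most twice, once as \<open>v\<close> and once as \<open>2 * v\<close>. So the risk is at least a constant times
  the sum of \<open>v powr (1 - \<alpha>)\<close> over \<open>v \<le> n / 2\<close>, and the three regimes of the theorem are the
  growth rates of this sum.
\<close>

section \<open>Recursive trees as parent functions\<close>

text \<open>The value 0 off \<open>{2..n}\<close> makes a parent function determined by its tree, and is a point that
  transpositions of positive labels fix.\<close>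
definition parent_choices :: "nat \<Rightarrow> (nat \<Rightarrow> nat) set" where
  "parent_choices n = PiE_dflt {2..n} 0 (\<lambda>k. {1..<k})"

definition parent_graph :: "nat \<Rightarrow> (nat \<Rightarrow> nat) \<Rightarrow> graph" where
  "parent_graph n f = (\<lambda>k. {f k, k}) ` {2..n}"

definition recursive_trees :: "nat \<Rightarrow> graph set" where
  "recursive_trees n = parent_graph n ` parent_choices n"

lemma parent_choices_bounds:
  assumes "f \<in> parent_choices n" "k \<in> {2..n}"
  shows "1 \<le> f k" "f k < k"
  using assms by (auto simp: parent_choices_def PiE_dflt_def dest!: spec[of _ k])

lemma parent_choices_default:
  assumes "f \<in> parent_choices n" "k \<notin> {2..n}"
  shows "f k = 0"
  using assms by (auto simp: parent_choices_def PiE_dflt_def)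

lemma finite_parent_choices: "finite (parent_choices n)"
  unfolding parent_choices_def by (rule finite_PiE_dflt) auto

lemma finite_recursive_trees: "finite (recursive_trees n)"
  unfolding recursive_trees_def using finite_parent_choices by simp

lemma parent_choices_nonempty: "parent_choices n \<noteq> {}"
  unfolding parent_choices_def by auto

lemma recursive_trees_nonempty: "recursive_trees n \<noteq> {}"
  unfolding recursive_trees_def using parent_choices_nonempty by simp

text \<open>An edge of the tree joins a vertex to its parent, and the larger end is the child. Hence
  the tree determines its parent function and has no cycles.\<close>
lemma smaller_neighbour_is_parent:
  assumes f: "f \<in> parent_choices n"
    and adj: "adjacent (parent_graph n f) u m" and less: "u < m"
  shows "m \<in> {2..n} \<and> u = f m"
proof -
  obtain k where k: "k \<in> {2..n}" "{u, m} = {f k, k}"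
    using adj unfolding adjacent_def parent_graph_def by auto
  have "f k < k" by (rule parent_choices_bounds(2)[OF f k(1)])
  with k less show ?thesis by (auto simp: doubleton_eq_iff)
qed

lemma inj_on_parent_graph: "inj_on (parent_graph n) (parent_choices n)"
proof (rule inj_onI)
  fix f g assume f: "f \<in> parent_choices n" and g: "g \<in> parent_choices n"
    and eq: "parent_graph n f = parent_graph n g"
  show "f = g"
  proof
    fix k
    show "f k = g k"
    proof (cases "k \<in> {2..n}")
      case True
      then have "adjacent (parent_graph n g) (f k) k"
        unfolding eq[symmetric] by (auto simp: adjacent_def parent_graph_def)
      from smaller_neighbour_is_parent[OF g this] parent_choices_bounds(2)[OF f True]
      show ?thesis by blast
    qed (simp add: parent_choices_default[OF f] parent_choices_default[OF g])
  qed
qed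

section \<open>Recursive trees are labeled trees\<close>

lemma adjacent_commute: "adjacent t x y \<longleftrightarrow> adjacent t y x"
  by (simp add: adjacent_def insert_commute)

lemma is_cycle_adjacent_next:
  assumes c: "is_cycle t p" and i: "i < length p"
  shows "adjacent t (p ! i) (p ! (Suc i mod length p))"
proof (cases "Suc i < length p")
  case True
  then show ?thesis using c by (auto simp: is_cycle_def successively_conv_nth)
next
  case False
  then have "Suc i = length p" using i by simp
  moreover have "p \<noteq> []" using i by auto
  ultimately show ?thesis
    using c by (simp add: is_cycle_def last_conv_nth hd_conv_nth flip: \<open>Suc i = length p\<close>)
qed

text \<open>The largest vertex of a cycle would have two distinct smaller neighbours, but a vertex has only
  one parent.\<close>
lemma parent_graph_acyclic:
  assumes f: "f \<in> parent_choices n"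
  shows "\<not> is_cycle (parent_graph n f) p"
proof
  let ?t = "parent_graph n f"
  let ?L = "length p"
  assume c: "is_cycle ?t p"
  then have L: "3 \<le> ?L" and d: "distinct p" by (auto simp: is_cycle_def)
  have "Max (set p) \<in> set p" using L by (intro Max_in) auto
  then obtain i where i: "i < ?L" "p ! i = Max (set p)" by (auto simp: in_set_conv_nth)
  \<comment> \<open>The positions after and before \<open>i\<close> on the cycle; they differ because the length is at least 3.\<close>
  define a where "a = Suc i mod ?L"
  define b where "b = (if i = 0 then ?L - 1 else i - 1)"
  have b: "b < ?L" "Suc b mod ?L = i" using L i by (auto simp: b_def)
  have a: "a < ?L" "a \<noteq> i" "a \<noteq> b"
    using L i by (auto simp: a_def b_def mod_Suc)
  have "b \<noteq> i" using L i by (auto simp: b_def)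
  have less: "p ! j < p ! i" if "j < ?L" "j \<noteq> i" for j
  proof -
    have "p ! j \<le> p ! i" unfolding i(2) using that by (intro Max_ge) auto
    moreover have "p ! j \<noteq> p ! i" using d that i(1) by (metis nth_eq_iff_index_eq)
    ultimately show ?thesis by simp
  qed
  have "adjacent ?t (p ! a) (p ! i)"
    using is_cycle_adjacent_next[OF c i(1)] by (simp add: a_def adjacent_commute)
  then have "p ! a = f (p ! i)"
    using smaller_neighbour_is_parent[OF f] less[OF a(1,2)] by blast
  moreover have "adjacent ?t (p ! b) (p ! i)"
    using is_cycle_adjacent_next[OF c b(1)] b(2) by simp
  then have "p ! b = f (p ! i)"
    using smaller_neighbour_is_parent[OF f] less[OF b(1) \<open>b \<noteq> i\<close>] by blast
  ultimately show False using nth_eq_iff_index_eq[OF d a(1) b(1)] a(3) by simp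
qed

lemma parent_graph_root_path:
  assumes f: "f \<in> parent_choices n" and "k \<in> {1..n}"
  shows "(adjacent (parent_graph n f))\<^sup>*\<^sup>* k 1"
  using assms(2)
proof (induction k rule: less_induct)
  case (less k)
  show ?case
  proof (cases "k = 1")
    case False
    then have k: "k \<in> {2..n}" using less.prems by auto
    note bounds = parent_choices_bounds[OF f k]
    have "adjacent (parent_graph n f) k (f k)"
      using k by (auto simp: adjacent_def parent_graph_def insert_commute)
    moreover have "(adjacent (parent_graph n f))\<^sup>*\<^sup>* (f k) 1"
      using bounds k by (intro less.IH) auto
    ultimately show ?thesis by (rule converse_rtranclp_into_rtranclp)
  qed simp
qed

lemma labeled_tree_recursive_trees:
  assumes "t \<in> recursive_trees n"
  shows "labeled_tree n t"
proof -
  obtain f where f: "f \<in> parent_choices n" and t: "t = parent_graph n f"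
    using assms by (auto simp: recursive_trees_def)
  have edges: "e \<subseteq> {1..n} \<and> card e = 2" if e: "e \<in> t" for e
  proof -
    obtain k where k: "k \<in> {2..n}" "e = {f k, k}"
      using e by (auto simp: t parent_graph_def)
    show ?thesis using parent_choices_bounds[OF f k(1)] k by auto
  qed
  have sym: "symp (adjacent t)\<^sup>*\<^sup>*"
    by (intro symp_rtranclp) (auto simp: symp_def adjacent_commute)
  have "(adjacent t)\<^sup>*\<^sup>* x y" if "x \<in> {1..n}" "y \<in> {1..n}" for x y
    using parent_graph_root_path[OF f that(1)] parent_graph_root_path[OF f that(2)]
      sympD[OF sym] by (auto simp: t intro: rtranclp_trans)
  with edges parent_graph_acyclic[OF f] show ?thesis
    unfolding labeled_tree_def by (auto simp: t)
qed

section \<open>The uniform law\<close>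

text \<open>The parents of the vertices are independent. In this form the probability of an event that
  restricts each parent separately is a product.\<close>
lemma urrt_conv_Pi_pmf:
  "urrt n = map_pmf (parent_graph n) (Pi_pmf {2..n} 0 (\<lambda>k. pmf_of_set {1..<k}))"
proof (induction n rule: urrt.induct)
  case (3 n)
  have ins: "{2..Suc (Suc n)} = insert (Suc (Suc n)) {2..Suc n}" by auto
  have graph: "parent_graph (Suc (Suc n)) (f(Suc (Suc n) := u)) =
      insert {u, Suc (Suc n)} (parent_graph (Suc n) f)" for f u
    unfolding parent_graph_def ins by (auto intro!: image_eqI)
  have "map_pmf (parent_graph (Suc (Suc n))) (Pi_pmf {2..Suc (Suc n)} 0 (\<lambda>k. pmf_of_set {1..<k}))
    = bind_pmf (pmf_of_set {1..<Suc (Suc n)}) (\<lambda>u.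
        bind_pmf (Pi_pmf {2..Suc n} 0 (\<lambda>k. pmf_of_set {1..<k})) (\<lambda>f.
          return_pmf (insert {u, Suc (Suc n)} (parent_graph (Suc n) f))))"
    unfolding ins by (subst Pi_pmf_insert')
      (auto simp: map_bind_pmf graph)
  also have "\<dots> = bind_pmf (Pi_pmf {2..Suc n} 0 (\<lambda>k. pmf_of_set {1..<k})) (\<lambda>f.
        bind_pmf (pmf_of_set {1..Suc n}) (\<lambda>u.
          return_pmf (insert {u, Suc (Suc n)} (parent_graph (Suc n) f))))"
    by (subst bind_commute_pmf) (simp add: atLeastLessThanSuc_atLeastAtMost)
  also have "\<dots> = urrt (Suc (Suc n))"
    by (simp add: 3 bind_map_pmf map_pmf_def bind_assoc_pmf bind_return_pmf)
  finally show ?case by simp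
qed (simp_all add: parent_graph_def)

lemma urrt_uniform: "urrt n = pmf_of_set (recursive_trees n)"
proof -
  have "Pi_pmf {2..n} 0 (\<lambda>k. pmf_of_set {1..<k}) = pmf_of_set (parent_choices n)"
    unfolding parent_choices_def by (rule Pi_pmf_of_set) auto
  then show ?thesis
    unfolding urrt_conv_Pi_pmf recursive_trees_def
    by (simp add: map_pmf_of_set_inj[OF inj_on_parent_graph parent_choices_nonempty
          finite_parent_choices])
qed

section \<open>Trees in which two labels can be exchanged\<close>

text \<open>Both the tree and its relabeling are required to be recursive, so that the relabeling maps this
  set onto itself.\<close>
definition swappable_trees :: "nat \<Rightarrow> nat \<Rightarrow> nat \<Rightarrow> graph set" where
  "swappable_trees n v w =
     {t \<in> recursive_trees n. relabel (Transposition.transpose v w) t \<in> recursive_trees n}"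

lemma relabel_transpose_involution:
  "relabel (Transposition.transpose v w) (relabel (Transposition.transpose v w) t) = t"
  by (simp add: relabel_def image_image)

lemma relabel_parent_graph:
  "relabel \<tau> (parent_graph n f) = (\<lambda>k. {\<tau> (f k), \<tau> k}) ` {2..n}"
  by (simp add: relabel_def parent_graph_def image_image)

lemma recursive_treesI: "f \<in> parent_choices n \<Longrightarrow> parent_graph n f \<in> recursive_trees n"
  by (simp add: recursive_trees_def)

text \<open>After the exchange every vertex must still have a smaller parent. This is at risk only for the
  new \<open>v\<close>, which inherits the parent of \<open>w\<close>, and for the old children of \<open>v\<close>, whose parent is
  now \<open>w\<close>; the new \<open>w\<close> and the old children of \<open>w\<close> have parents smaller
  than \<open>v\<close> and equal to \<open>v\<close>, respectively. The assumption \<open>2 \<le> v\<close> excludes the root, which has no parent to pass on.\<close>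
lemma swappable_treesI:
  assumes f: "f \<in> parent_choices n" and v: "2 \<le> v" "v < w" "w \<le> n"
    and parent: "f w < v" and children: "\<And>k. v < k \<Longrightarrow> k < w \<Longrightarrow> f k \<noteq> v"
  shows "parent_graph n f \<in> swappable_trees n v w"
proof -
  define \<tau> where "\<tau> = Transposition.transpose v w"
  \<comment> \<open>The parent function of the relabeled tree\<close>
  define g where "g = \<tau> \<circ> f \<circ> \<tau>"
  have g: "g \<in> parent_choices n"
    unfolding parent_choices_def PiE_dflt_def
  proof (intro CollectI allI conjI impI)
    fix k assume k: "k \<in> {2..n}"
    have w: "w \<in> {2..n}" and v': "v \<in> {2..n}" using v by auto
    note bounds = parent_choices_bounds[OF f k] parent_choices_bounds[OF f w]
      parent_choices_bounds[OF f v']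
    have "w \<le> k" if "f k = v"
      using children[of k] bounds(2) that by force
    then show "g k \<in> {1..<k}"
      using v parent bounds
      by (auto simp: g_def \<tau>_def Transposition.transpose_def)
  next
    fix k assume k: "k \<notin> {2..n}"
    then have "f k = 0" by (rule parent_choices_default[OF f])
    then show "g k = 0" using v k by (auto simp: g_def \<tau>_def Transposition.transpose_def)
  qed
  have im: "\<tau> ` {2..n} = {2..n}"
    unfolding \<tau>_def using v by (intro permutes_image permutes_swap_id) auto
  have "parent_graph n g = (\<lambda>k. {g k, k}) ` \<tau> ` {2..n}" by (simp add: im parent_graph_def)
  also have "\<dots> = relabel \<tau> (parent_graph n f)"
    by (simp add: relabel_parent_graph image_image g_def \<tau>_def)
  finally have "relabel \<tau> (parent_graph n f) \<in> recursive_trees n"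
    using recursive_treesI[OF g] by simp
  then show ?thesis by (simp add: swappable_trees_def \<tau>_def recursive_treesI[OF f])
qed

text \<open>The graph is unrooted, so the edge between 1 and 2 looks the same after the exchange, and every
  other vertex is larger than both.\<close>
lemma swappable_root:
  assumes "2 \<le> n"
  shows "swappable_trees n 1 2 = recursive_trees n"
proof -
  have "relabel (Transposition.transpose 1 2) (parent_graph n f) \<in> recursive_trees n"
    if f: "f \<in> parent_choices n" for f
  proof -
    define \<tau> where "\<tau> = Transposition.transpose (1::nat) 2"
    \<comment> \<open>Conjugating \<open>f\<close> by \<open>\<tau>\<close> would make 2 the parent of 1; the edge is turned around instead.\<close>
    define g where "g = (\<lambda>k. if k = 2 then 1 else \<tau> (f k))"
    have g: "g \<in> parent_choices n"
      unfolding parent_choices_def PiE_dflt_def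
    proof (intro CollectI allI conjI impI)
      fix k assume k: "k \<in> {2..n}"
      show "g k \<in> {1..<k}"
        using parent_choices_bounds[OF f k] k by (auto simp: g_def \<tau>_def Transposition.transpose_def)
    next
      fix k assume k: "k \<notin> {2..n}"
      then have "f k = 0" by (rule parent_choices_default[OF f])
      then show "g k = 0" using assms k by (auto simp: g_def \<tau>_def Transposition.transpose_def)
    qed
    have two: "f 2 = 1" using parent_choices_bounds[OF f, of 2] assms by simp
    have "{\<tau> (f k), \<tau> k} = {g k, k}" if "k \<in> {2..n}" for k
      using that two by (auto simp: g_def \<tau>_def Transposition.transpose_def)
    then have "relabel \<tau> (parent_graph n f) = parent_graph n g"
      unfolding relabel_parent_graph unfolding parent_graph_def by (rule image_cong[OF refl])
    then show ?thesis using recursive_treesI[OF g] by (simp add: \<tau>_def)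
  qed
  then show ?thesis by (auto simp: swappable_trees_def recursive_trees_def)
qed

text \<open>The probability that \<open>v\<close> gets no child among the vertices arriving between \<open>v\<close> and \<open>w\<close>: the
  vertex \<open>k\<close> avoids one of its \<open>k - 1\<close> possible parents.\<close>
lemma prod_telescope_no_child:
  assumes "2 \<le> v" "v < w"
  shows "(\<Prod>k\<in>{v<..<w}. real (k - 2) / real (k - 1)) = real (v - 1) / real (w - 2)"
proof -
  have "Suc v \<le> w" using assms by simp
  then show ?thesis
  proof (induction w rule: dec_induct)
    case base
    have "{v<..<Suc v} = {}" by auto
    then show ?case using assms by simp
  next
    case (step w)
    have "{v<..<Suc w} = insert w {v<..<w}" using step by auto
    then show ?case using step assms by simp
  qed
qed

text \<open>The two factors are the probabilities that \<open>v\<close> has no child before \<open>w\<close> and that the parent of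
  \<open>w\<close> is smaller than \<open>v\<close>.\<close>
lemma prob_swappable_trees_ge:
  assumes v: "2 \<le> v" "v < w" "w \<le> n"
  shows "measure_pmf.prob (urrt n) (swappable_trees n v w) \<ge>
    real (v - 1) / real (w - 2) * (real (v - 1) / real (w - 1))"
proof -
  define B where "B k = (if k = w then {1..<v} else if v < k \<and> k < w then {1..<k} - {v}
    else {1..<k})" for k
  define P where "P = Pi_pmf {2..n} 0 (\<lambda>k. pmf_of_set {1..<k})"
  have prob_B: "measure_pmf.prob (pmf_of_set {1..<k}) (B k) =
      (if k = w then real (v - 1) / real (w - 1)
       else if v < k \<and> k < w then real (k - 2) / real (k - 1) else 1)" if "k \<in> {2..n}" for k
  proof -
    have "{1..<k} \<inter> B k = B k" using v by (auto simp: B_def)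
    moreover have "card ({1..<k} - {v}) = k - 2" if "v < k"
      using that v by (subst card_Diff_singleton) auto
    ultimately show ?thesis using that v
      by (subst measure_pmf_of_set) (auto simp: B_def)
  qed
  have "(\<Prod>k\<in>{2..n}. measure_pmf.prob (pmf_of_set {1..<k}) (B k)) =
      (\<Prod>k\<in>insert w {v<..<w}. measure_pmf.prob (pmf_of_set {1..<k}) (B k))"
    using v prob_B by (intro prod.mono_neutral_right) auto
  also have "\<dots> = (\<Prod>k\<in>insert w {v<..<w}. if k = w then real (v - 1) / real (w - 1)
      else real (k - 2) / real (k - 1))"
    using v by (intro prod.cong refl) (subst prob_B, auto)
  also have "\<dots> = real (v - 1) / real (w - 1) *
      (\<Prod>k\<in>{v<..<w}. real (k - 2) / real (k - 1))"
    by (simp add: prod.insert)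
  also have "\<dots> = real (v - 1) / real (w - 2) * (real (v - 1) / real (w - 1))"
    unfolding prod_telescope_no_child[OF v(1,2)] by (rule mult.commute)
  finally have "real (v - 1) / real (w - 2) * (real (v - 1) / real (w - 1)) =
      measure_pmf.prob P (PiE_dflt {2..n} 0 B)"
    unfolding P_def by (subst measure_Pi_pmf_PiE_dflt) simp_all
  also have "\<dots> \<le> measure_pmf.prob P (parent_graph n -` swappable_trees n v w)"
  proof (intro measure_pmf.finite_measure_mono subsetI vimageI2)
    fix f assume f: "f \<in> PiE_dflt {2..n} 0 B"
    have B: "f k \<in> B k" if "k \<in> {2..n}" for k using f that by (auto simp: PiE_dflt_def)
    have sub: "B k \<subseteq> {1..<k}" for k using v by (auto simp: B_def)
    have "f \<in> parent_choices n"
      using f sub unfolding parent_choices_def PiE_dflt_def by blast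
    moreover have "f w < v" using B[of w] v by (simp add: B_def)
    moreover have "f k \<noteq> v" if "v < k" "k < w" for k
      using B[of k] v that by (auto simp: B_def)
    ultimately show "parent_graph n f \<in> swappable_trees n v w"
      using v by (intro swappable_treesI)
  qed auto
  also have "\<dots> = measure_pmf.prob (urrt n) (swappable_trees n v w)"
    by (simp add: urrt_conv_Pi_pmf P_def)
  finally show ?thesis .
qed

lemma prob_swappable_double_ge:
  assumes "1 \<le> v" "2 * v \<le> n"
  shows "measure_pmf.prob (urrt n) (swappable_trees n v (2 * v)) \<ge> 1 / 6"
proof (cases "v = 1")
  case True
  have "measure_pmf.prob (urrt n) (recursive_trees n) = 1"
    using finite_recursive_trees[of n] recursive_trees_nonempty[of n]
    by (simp add: urrt_uniform measure_pmf_of_set)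
  then show ?thesis using True assms swappable_root[of n] by simp
next
  case False
  then have v: "2 \<le> v" using assms by simp
  have "1 / 6 \<le> real (v - 1) / real (2 * v - 2) * (real (v - 1) / real (2 * v - 1))"
  proof -
    have half: "real (v - 1) / real (2 * v - 2) = 1 / 2" using v by (simp add: of_nat_diff field_simps)
    have "1 / 3 \<le> real (v - 1) / real (2 * v - 1)"
      using v by (simp add: of_nat_diff field_simps)
    then have "1 / 2 * (1 / 3) \<le> 1 / 2 * (real (v - 1) / real (2 * v - 1))"
      by (rule mult_left_mono) simp
    then show ?thesis unfolding half by simp
  qed
  also have "\<dots> \<le> measure_pmf.prob (urrt n) (swappable_trees n v (2 * v))"
    using v assms by (intro prob_swappable_trees_ge) auto
  finally show ?thesis .
qed

section \<open>Errors at exchangeable vertices\<close>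

definition arrival_error :: "nat \<Rightarrow> estimator \<Rightarrow> nat \<Rightarrow> real" where
  "arrival_error n \<sigma> v =
     measure_pmf.expectation (bind_pmf (urrt n) \<sigma>) (\<lambda>s. \<bar>real (s v) - real v\<bar>)"

lemma finite_estimator_support:
  assumes "is_estimator n \<sigma>" "t \<in> recursive_trees n"
  shows "finite (set_pmf (\<sigma> t))"
proof (rule finite_subset)
  show "set_pmf (\<sigma> t) \<subseteq> {s. s permutes {1..n}}"
    using assms labeled_tree_recursive_trees by (auto simp: is_estimator_def)
qed (simp add: finite_permutations)

lemma arrival_error_nonneg: "arrival_error n \<sigma> v \<ge> 0"
  by (simp add: arrival_error_def)

lemma risk_conv_arrival_error:
  assumes "is_estimator n \<sigma>"
  shows "risk \<alpha> n \<sigma> = (\<Sum>v\<in>{1..n}. arrival_error n \<sigma> v / real v powr \<alpha>)"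
proof -
  have fin: "finite (set_pmf (bind_pmf (urrt n) \<sigma>))"
    using finite_recursive_trees[of n] recursive_trees_nonempty[of n]
      finite_estimator_support[OF assms] by (simp add: urrt_uniform)
  show ?thesis
    unfolding risk_def arrival_error_def
    by (subst Bochner_Integration.integral_sum)
      (auto intro!: integrable_measure_pmf_finite[OF fin])
qed

text \<open>Invariance in the form used below: the expectation of any function of the single guess is
  carried along by the relabeling.\<close>
lemma label_invariant_expectation:
  assumes "label_invariant n \<sigma>" "labeled_tree n t" "\<tau> permutes {1..n}" "u \<in> {1..n}"
  shows "measure_pmf.expectation (\<sigma> (relabel \<tau> t)) (\<lambda>s. h (s (\<tau> u))) =
    measure_pmf.expectation (\<sigma> t) (\<lambda>s. h (s u) :: real)"
proof -
  have "map_pmf (\<lambda>s. s u) (\<sigma> t) = map_pmf (\<lambda>s. s (\<tau> u)) (\<sigma> (relabel \<tau> t))"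
    using assms by (auto simp: label_invariant_def)
  then have "measure_pmf.expectation (map_pmf (\<lambda>s. s u) (\<sigma> t)) h =
      measure_pmf.expectation (map_pmf (\<lambda>s. s (\<tau> u)) (\<sigma> (relabel \<tau> t))) h"
    by simp
  then show ?thesis by simp
qed

text \<open>On the set of trees in which \<open>v\<close> and \<open>w\<close> can be exchanged, the error at \<open>w\<close> averages
  to the mean distance between the guess for \<open>v\<close> and the wrong target \<open>w\<close>: reindex by the
  exchange, which preserves the uniform law, and apply invariance. Then the triangle inequality
  through the guess for \<open>v\<close> bounds the sum of both errors.\<close>
lemma arrival_error_pair_ge:
  assumes est: "is_estimator n \<sigma>" and inv: "label_invariant n \<sigma>"
    and v: "v \<in> {1..n}" and w: "w \<in> {1..n}"
  shows "arrival_error n \<sigma> v + arrival_error n \<sigma> w \<ge>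
    \<bar>real v - real w\<bar> * measure_pmf.prob (urrt n) (swappable_trees n v w)"
proof -
  define \<tau> where "\<tau> = Transposition.transpose v w"
  define A where "A = swappable_trees n v w"
  define N where "N = real (card (recursive_trees n))"
  define e where "e t u x = measure_pmf.expectation (\<sigma> t) (\<lambda>s. \<bar>real (s u) - real x\<bar>)"
    for t u x
  note fin = finite_recursive_trees[of n] and ne = recursive_trees_nonempty[of n]
  have N: "N > 0" using fin ne by (simp add: N_def card_gt_0_iff)
  have A: "A \<subseteq> recursive_trees n" by (auto simp: A_def swappable_trees_def)
  have \<tau>: "\<tau> permutes {1..n}" unfolding \<tau>_def using v w by (intro permutes_swap_id)
  have error: "arrival_error n \<sigma> u \<ge> (\<Sum>t\<in>A. e t u u) / N" for u
  proof -
    have "(\<Sum>t\<in>A. e t u u) \<le> (\<Sum>t\<in>recursive_trees n. e t u u)"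
      using fin A by (intro sum_mono2) (auto simp: e_def)
    then have "(\<Sum>t\<in>A. e t u u) / N \<le> (\<Sum>t\<in>recursive_trees n. e t u u) / N"
      using N by (simp add: divide_right_mono)
    also have "\<dots> = arrival_error n \<sigma> u"
      unfolding arrival_error_def urrt_uniform
      by (subst pmf_expectation_bind_pmf_of_set[OF ne fin])
        (auto simp: finite_estimator_support[OF est] e_def N_def divide_inverse sum_distrib_left
          mult.commute)
    finally show ?thesis .
  qed
  have bij: "bij_betw (relabel \<tau>) A A"
    by (rule bij_betw_byWitness[where f' = "relabel \<tau>"])
      (auto simp: \<tau>_def A_def swappable_trees_def relabel_transpose_involution)
  have "(\<Sum>t\<in>A. e t w w) = (\<Sum>t\<in>A. e (relabel \<tau> t) w w)"
    by (rule sum.reindex_bij_betw[OF bij, symmetric])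
  also have "\<dots> = (\<Sum>t\<in>A. e t v w)"
  proof (rule sum.cong[OF refl])
    fix t assume "t \<in> A"
    then have "labeled_tree n t" using A labeled_tree_recursive_trees by blast
    from label_invariant_expectation[OF inv this \<tau> v, of "\<lambda>x. \<bar>real x - real w\<bar>"]
    show "e (relabel \<tau> t) w w = e t v w" by (simp add: e_def \<tau>_def)
  qed
  finally have swap: "(\<Sum>t\<in>A. e t w w) = (\<Sum>t\<in>A. e t v w)" .
  have triangle: "\<bar>real v - real w\<bar> \<le> e t v v + e t v w" if "t \<in> A" for t
  proof -
    have int: "integrable (\<sigma> t) h" for h :: "(nat \<Rightarrow> nat) \<Rightarrow> real"
      using that A finite_estimator_support[OF est] by (intro integrable_measure_pmf_finite) auto
    have "\<bar>real v - real w\<bar> = measure_pmf.expectation (\<sigma> t) (\<lambda>s. \<bar>real v - real w\<bar>)" by simp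
    also have "\<dots> \<le> measure_pmf.expectation (\<sigma> t)
        (\<lambda>s. \<bar>real (s v) - real v\<bar> + \<bar>real (s v) - real w\<bar>)"
      by (intro integral_mono int) auto
    also have "\<dots> = e t v v + e t v w"
      unfolding e_def by (intro Bochner_Integration.integral_add int)
    finally show ?thesis .
  qed
  have "real (card A) * \<bar>real v - real w\<bar> \<le> (\<Sum>t\<in>A. e t v v + e t v w)"
    using sum_mono[of A "\<lambda>_. \<bar>real v - real w\<bar>", OF triangle] by simp
  also have "\<dots> = (\<Sum>t\<in>A. e t v v) + (\<Sum>t\<in>A. e t w w)" by (simp add: sum.distrib swap)
  finally have "real (card A) * \<bar>real v - real w\<bar> / N \<le>
      (\<Sum>t\<in>A. e t v v) / N + (\<Sum>t\<in>A. e t w w) / N"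
    using N by (simp add: divide_right_mono flip: add_divide_distrib)
  also have "\<dots> \<le> arrival_error n \<sigma> v + arrival_error n \<sigma> w" by (intro add_mono error)
  also have "real (card A) * \<bar>real v - real w\<bar> / N =
      \<bar>real v - real w\<bar> * measure_pmf.prob (urrt n) A"
    using fin ne A by (simp add: urrt_uniform measure_pmf_of_set N_def Int_absorb1)
  finally show ?thesis by (simp add: A_def)
qed

section \<open>From pairs to the risk\<close>

text \<open>The errors at \<open>v\<close> and \<open>2 * v\<close> add up to at least \<open>v / 6\<close>, and both are weighted by
  at least \<open>(2 * v) powr (-\<alpha>)\<close>. The further factor 2 in the constant pays for vertices that occur
  both as \<open>v\<close> and as a double.\<close>
lemma risk_ge_power_sum:
  assumes est: "is_estimator n \<sigma>" and inv: "label_invariant n \<sigma>" and \<alpha>: "\<alpha> > 0"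
  shows "risk \<alpha> n \<sigma> \<ge> 2 powr (-\<alpha>) / 12 * (\<Sum>v\<in>{1..n div 2}. real v powr (1 - \<alpha>))"
proof -
  define D where "D = arrival_error n \<sigma>"
  define m where "m = n div 2"
  have D0: "D v \<ge> 0" for v by (simp add: D_def arrival_error_nonneg)
  have risk: "risk \<alpha> n \<sigma> = (\<Sum>v\<in>{1..n}. D v / real v powr \<alpha>)"
    by (simp add: D_def risk_conv_arrival_error[OF est])
  have low: "(\<Sum>v\<in>{1..m}. D v / real v powr \<alpha>) \<le> risk \<alpha> n \<sigma>"
    unfolding risk by (intro sum_mono2) (auto simp: m_def D0)
  have "(\<Sum>v\<in>{1..m}. D (2 * v) / real (2 * v) powr \<alpha>) =
      (\<Sum>v\<in>(*) 2 ` {1..m}. D v / real v powr \<alpha>)"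
    by (subst sum.reindex) (auto simp: inj_on_def)
  also have "\<dots> \<le> risk \<alpha> n \<sigma>"
    unfolding risk by (intro sum_mono2) (auto simp: m_def D0)
  finally have high: "(\<Sum>v\<in>{1..m}. D (2 * v) / real (2 * v) powr \<alpha>) \<le> risk \<alpha> n \<sigma>" .
  have pair: "2 powr (-\<alpha>) / 6 * real v powr (1 - \<alpha>) \<le>
      D v / real v powr \<alpha> + D (2 * v) / real (2 * v) powr \<alpha>" if "v \<in> {1..m}" for v
  proof -
    have v: "1 \<le> v" "2 * v \<le> n" using that by (auto simp: m_def)
    have "real v / 6 \<le> real v * measure_pmf.prob (urrt n) (swappable_trees n v (2 * v))"
      using prob_swappable_double_ge[OF v] mult_left_mono[of "1/6" _ "real v"] by simp
    also have "\<dots> \<le> D v + D (2 * v)"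
      using arrival_error_pair_ge[OF est inv, of v "2 * v"] v by (simp add: D_def)
    finally have sum: "real v / 6 \<le> D v + D (2 * v)" .
    have "2 powr (-\<alpha>) / 6 * real v powr (1 - \<alpha>) = (real v / 6) / real (2 * v) powr \<alpha>"
      using v by (simp add: powr_minus powr_diff powr_mult divide_simps)
    also have "\<dots> \<le> (D v + D (2 * v)) / real (2 * v) powr \<alpha>"
      by (intro divide_right_mono sum) simp
    also have "\<dots> = D v / real (2 * v) powr \<alpha> + D (2 * v) / real (2 * v) powr \<alpha>"
      by (rule add_divide_distrib)
    also have "D v / real (2 * v) powr \<alpha> \<le> D v / real v powr \<alpha>"
      using v \<alpha> by (intro divide_left_mono D0 powr_mono2) auto
    finally show ?thesis by simp
  qed
  have "2 powr (-\<alpha>) / 6 * (\<Sum>v\<in>{1..m}. real v powr (1 - \<alpha>)) =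
      (\<Sum>v\<in>{1..m}. 2 powr (-\<alpha>) / 6 * real v powr (1 - \<alpha>))"
    by (rule sum_distrib_left)
  also have "\<dots> \<le> (\<Sum>v\<in>{1..m}. D v / real v powr \<alpha> + D (2 * v) / real (2 * v) powr \<alpha>)"
    by (rule sum_mono[OF pair])
  also have "\<dots> \<le> 2 * risk \<alpha> n \<sigma>"
    using low high by (simp add: sum.distrib)
  finally show ?thesis by (simp add: m_def)
qed

section \<open>Growth of the power sums\<close>

text \<open>With \<open>m = n div 2\<close>, the terms with \<open>v \<ge> m / 2\<close> are comparable to \<open>m powr (1 - \<alpha>)\<close>
  whatever the sign of the exponent, and there are at least \<open>m / 2\<close> of them. Since
  \<open>m \<ge> n / 3\<close> and \<open>2 - \<alpha> \<le> 2\<close>, passing from \<open>m\<close> to \<open>n\<close> costs at most a factor 9.\<close>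
lemma power_sum_half_ge_powr:
  assumes n: "2 \<le> n" and \<alpha>: "0 < \<alpha>" "\<alpha> < 2"
  shows "(\<Sum>v\<in>{1..n div 2}. real v powr (1 - \<alpha>)) \<ge> real n powr (2 - \<alpha>) / 36"
proof -
  define m where "m = n div 2"
  have "n \<le> 3 * m" using n unfolding m_def by presburger
  then have m: "1 \<le> m" "real n / 3 \<le> real m" using n by (auto simp: m_def)
  have upper_half: "real m powr (1 - \<alpha>) / 2 \<le> real v powr (1 - \<alpha>)"
    if v: "v \<in> {m - m div 2..m}" for v
  proof -
    have "1 \<le> v" "real m / 2 \<le> real v" "v \<le> m" using v m by auto
    show ?thesis
    proof (cases "\<alpha> \<le> 1")
      case True
      have "(1 / 2 :: real) powr 1 \<le> (1 / 2) powr (1 - \<alpha>)" using True \<alpha> by (intro powr_mono') auto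
      then have "real m powr (1 - \<alpha>) / 2 \<le> real m powr (1 - \<alpha>) * (1 / 2) powr (1 - \<alpha>)"
        using mult_left_mono[of "1/2" "(1 / 2 :: real) powr (1 - \<alpha>)" "real m powr (1 - \<alpha>)"]
        by simp
      also have "\<dots> = (real m / 2) powr (1 - \<alpha>)"
        by (simp add: powr_mult[symmetric])
      also have "\<dots> \<le> real v powr (1 - \<alpha>)"
        using \<open>real m / 2 \<le> real v\<close> True by (intro powr_mono2) auto
      finally show ?thesis .
    next
      case False
      have "real m powr (1 - \<alpha>) / 2 \<le> real m powr (1 - \<alpha>)" by simp
      also have "\<dots> \<le> real v powr (1 - \<alpha>)"
        using False \<open>1 \<le> v\<close> \<open>v \<le> m\<close> by (intro powr_mono2') auto
      finally show ?thesis .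
    qed
  qed
  have "real n powr (2 - \<alpha>) / 36 \<le> (real n / 3) powr (2 - \<alpha>) / 4"
  proof -
    have "(3::real) powr (2 - \<alpha>) \<le> 3 powr 2" using \<alpha> by (intro powr_mono) auto
    then have "real n powr (2 - \<alpha>) / 9 \<le> real n powr (2 - \<alpha>) / 3 powr (2 - \<alpha>)"
      by (intro divide_left_mono) auto
    then show ?thesis by (simp add: powr_divide mult.commute)
  qed
  also have "\<dots> \<le> real m powr (2 - \<alpha>) / 4"
    using m \<alpha> by (intro divide_right_mono powr_mono2) auto
  also have "\<dots> = real m / 2 * (real m powr (1 - \<alpha>) / 2)"
    using m powr_add[of "real m" 1 "1 - \<alpha>"] by (simp add: add.commute)
  also have "\<dots> \<le> real (card {m - m div 2..m}) * (real m powr (1 - \<alpha>) / 2)"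
    by (intro mult_right_mono) auto
  also have "\<dots> \<le> (\<Sum>v\<in>{m - m div 2..m}. real v powr (1 - \<alpha>))"
    using upper_half by (intro sum_bounded_below)
  also have "\<dots> \<le> (\<Sum>v\<in>{1..m}. real v powr (1 - \<alpha>))"
    using m by (intro sum_mono2) auto
  finally show ?thesis by (simp add: m_def)
qed

text \<open>The harmonic sum up to \<open>n div 2\<close> is at least the logarithm of \<open>n div 2 + 1\<close>, whose square
  is at least \<open>n\<close>.\<close>
lemma inverse_sum_half_ge_ln:
  assumes n: "2 \<le> n"
  shows "(\<Sum>v\<in>{1..n div 2}. real v powr (1 - 2)) \<ge> ln (real n) / 2"
proof -
  define m where "m = n div 2"
  have "n \<le> 2 * m + 1" by (simp add: m_def)
  also have "\<dots> \<le> (m + 1)\<^sup>2" by (simp add: power2_eq_square)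
  finally have "real n \<le> (real m + 1)\<^sup>2" by (metis of_nat_1 of_nat_add of_nat_le_iff of_nat_power)
  then have "ln (real n) \<le> ln ((real m + 1)\<^sup>2)" using n by (intro ln_mono) auto
  also have "\<dots> = 2 * ln (real m + 1)" by (simp add: ln_realpow)
  also have "\<dots> \<le> 2 * harm m" using ln_le_harm[of m] by simp
  also have "harm m = (\<Sum>v\<in>{1..m}. real v powr (1 - 2))"
    unfolding harm_def by (intro sum.cong) (auto simp: powr_minus)
  finally show ?thesis by (simp add: m_def)
qed

section \<open>The lower bound on the risk\<close>

theorem corollary1p6:
  fixes \<alpha> :: real
  assumes "\<alpha> > 0"
  shows "\<exists>c::real. c > 0 \<and>
    (\<forall>(n::nat) \<sigma>. n \<ge> 2 \<and> is_estimator n \<sigma> \<and> label_invariant n \<sigma> \<longrightarrow>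
      risk \<alpha> n \<sigma> \<ge>
        (if \<alpha> < 2 then c * real n powr (2 - \<alpha>)
         else if \<alpha> = 2 then c * ln (real n)
         else c))"
proof -
  define b where "b = 2 powr (-\<alpha>) / 12"
  have b: "b > 0" by (simp add: b_def)
  have "risk \<alpha> n \<sigma> \<ge> (if \<alpha> < 2 then b / 36 * real n powr (2 - \<alpha>)
       else if \<alpha> = 2 then b / 36 * ln (real n) else b / 36)"
    if n: "n \<ge> 2" and est: "is_estimator n \<sigma>" and inv: "label_invariant n \<sigma>" for n \<sigma>
  proof -
    define S where "S = (\<Sum>v\<in>{1..n div 2}. real v powr (1 - \<alpha>))"
    have risk: "b * S \<le> risk \<alpha> n \<sigma>"
      unfolding b_def S_def by (rule risk_ge_power_sum[OF est inv assms])
    \<comment> \<open>The first term alone settles the regime \<open>\<alpha> > 2\<close>.\<close>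
    have "real 1 powr (1 - \<alpha>) \<le> S"
      unfolding S_def using n by (intro member_le_sum) auto
    then have one: "1 / 36 \<le> S" by simp
    have "(if \<alpha> < 2 then real n powr (2 - \<alpha>) else if \<alpha> = 2 then ln (real n) else 1) / 36 \<le> S"
    proof -
      have "ln (real n) / 36 \<le> S" if "\<alpha> = 2"
      proof -
        have "ln (real n) \<ge> 0" using n by simp
        then show ?thesis using inverse_sum_half_ge_ln[OF n] that by (simp add: S_def)
      qed
      then show ?thesis
        using one power_sum_half_ge_powr[OF n assms] by (auto simp: S_def)
    qed
    then have "b * ((if \<alpha> < 2 then real n powr (2 - \<alpha>) else if \<alpha> = 2 then ln (real n) else 1) / 36)
        \<le> b * S"
      using b by (intro mult_left_mono) auto
    with risk show ?thesis by (auto split: if_splits)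
  qed
  then show ?thesis using b by (intro exI[of _ "b / 36"]) auto
qed

end
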